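(* Let $G$ be a finite graph with chromatic number $3$. Then $\theta(G)=1$ if and only if $\chi_c(G)=3$.
   Context: For a positive integer $k$, $G^{k}$ has vertex set $V(G)$, with $u,v$ adjacent iff there is a walk of length $k$ between them in $G$. $S_t(G)$ replaces each edge by a path with exactly $t-1$ inner vertices, and $G^{\frac{2r+1}{2s+1}}:=(S_{2s+1}(G))^{2r+1}$ for non-negative integers $r,s$. $og(G)$ is the odd girth. For a non-bipartite graph $G$, $\theta(G):=\sup\{\frac{2r+1}{2s+1}: r,s\ge 0 \text{ integers},\ \chi(G^{\frac{2r+1}{2s+1}})\le\chi(G),\ \frac{2r+1}{2s+1}<og(G)\}$. For integers $n\ge 2d\ge 2$, $K_{n/d}$ has vertices $v_0,\ldots,v_{n-1}$ with $v_iv_j$ an edge iff $d\le|i-j|\le n-d$; the circular chromatic number $\chi_c(G)$ is the minimum of $n/d$ such that $G$ has a homomorphism to $K_{n/d}$. *)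

theory Defs
  imports
    Complex_Main
    "HOL-Library.Multiset"
    "HOL-Library.Extended_Real"
    "Graph_Theory.Pair_Digraph"
begin

text \<open>
  An undirected graph is a symmetric pair digraph; a finite simple graph is one satisfying the
  locale predicate \<^const>\<open>pair_graph\<close>. Graph powers may have loops, so the notions below are
  defined for arbitrary pair digraphs.
\<close>

definition graph_hom :: "'a pair_pre_digraph \<Rightarrow> 'b pair_pre_digraph \<Rightarrow> ('a \<Rightarrow> 'b) \<Rightarrow> bool" where
  "graph_hom G H f \<longleftrightarrow>
     f ` pverts G \<subseteq> pverts H \<and> (\<forall>u v. (u, v) \<in> parcs G \<longrightarrow> (f u, f v) \<in> parcs H)"

definition colourable :: "nat \<Rightarrow> 'a pair_pre_digraph \<Rightarrow> bool" where
  "colourable n G \<longleftrightarrow>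
     (\<exists>c :: 'a \<Rightarrow> nat. c ` pverts G \<subseteq> {..<n} \<and> (\<forall>u v. (u, v) \<in> parcs G \<longrightarrow> c u \<noteq> c v))"

text \<open>The value is \<open>\<infinity>\<close> if there is no finite proper colouring, e.g. if \<open>G\<close> has a loop.\<close>

definition chromatic_number :: "'a pair_pre_digraph \<Rightarrow> enat" where
  "chromatic_number G = Inf {enat n |n. colourable n G}"

text \<open>
  The cycles of a symmetric digraph include closed walks \<open>a, b, a\<close> of length 2, but every cycle of
  odd length at least 3 is a cycle of the undirected graph. The odd girth is \<open>\<infinity>\<close> if there is no odd cycle.
\<close>

definition odd_girth :: "'a pair_pre_digraph \<Rightarrow> enat" where
  "odd_girth G = Inf {enat (length p) |p. pre_digraph.cycle (with_proj G) p \<and> odd (length p)}"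

definition graph_power :: "nat \<Rightarrow> 'a pair_pre_digraph \<Rightarrow> 'a pair_pre_digraph" where
  "graph_power k G =
     \<lparr> pverts = pverts G,
       parcs = {(u, v). \<exists>p. pre_digraph.awalk (with_proj G) u p v \<and> length p = k} \<rparr>"

text \<open>
  The vertex at distance \<open>i\<close> from \<open>u\<close> on the path of length \<open>t\<close> replacing the edge \<open>uv\<close> is encoded
  by its barycentric coordinates with respect to \<open>u\<close> and \<open>v\<close>, i.e. as the multiset containing
  \<open>u\<close> with multiplicity \<open>t - i\<close> and \<open>v\<close> with multiplicity \<open>i\<close>. This does not depend on
  the direction in which the edge is traversed, and the original vertex \<open>u\<close> becomes
  the multiset containing \<open>u\<close> with multiplicity \<open>t\<close>.
\<close>

definition subdiv_point :: "nat \<Rightarrow> 'a \<Rightarrow> 'a \<Rightarrow> nat \<Rightarrow> 'a multiset" where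
  "subdiv_point t u v i = replicate_mset (t - i) u + replicate_mset i v"

definition edge_subdivision :: "nat \<Rightarrow> 'a pair_pre_digraph \<Rightarrow> 'a multiset pair_pre_digraph" where
  "edge_subdivision t G =
     \<lparr> pverts = {replicate_mset t u |u. u \<in> pverts G}
              \<union> {subdiv_point t u v i |u v i. (u, v) \<in> parcs G \<and> 0 < i \<and> i < t},
       parcs = {(x, y). \<exists>u v i. (u, v) \<in> parcs G \<and> i < t \<and>
                  {x, y} = {subdiv_point t u v i, subdiv_point t u v (Suc i)}} \<rparr>"

lemma subdiv_point_ends [simp]:
  "subdiv_point t u v 0 = replicate_mset t u"
  "subdiv_point t u v t = replicate_mset t v"
  by (simp_all add: subdiv_point_def)

lemma subdiv_point_swap: "i \<le> t \<Longrightarrow> subdiv_point t u v i = subdiv_point t v u (t - i)"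
  by (simp add: subdiv_point_def add.commute)

lemma inner_subdiv_point_eq_iff:
  assumes "u \<noteq> v" "u' \<noteq> v'" "0 < i" "i < t" "0 < j" "j < t"
  shows "subdiv_point t u v i = subdiv_point t u' v' j \<longleftrightarrow>
           u = u' \<and> v = v' \<and> i = j \<or> u = v' \<and> v = u' \<and> i = t - j"
proof
  assume eq: "subdiv_point t u v i = subdiv_point t u' v' j"
  have "{u, v} = {u', v'}"
    using arg_cong[OF eq, of set_mset] assms by (auto simp: subdiv_point_def split: if_splits)
  then have *: "u = u' \<and> v = v' \<or> u = v' \<and> v = u'"
    by (auto simp: doubleton_eq_iff)
  have "count (subdiv_point t u v i) v = count (subdiv_point t u' v' j) v"
    using eq by simp
  then show "u = u' \<and> v = v' \<and> i = j \<or> u = v' \<and> v = u' \<and> i = t - j"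
    using * assms by (auto simp: subdiv_point_def)
next
  assume "u = u' \<and> v = v' \<and> i = j \<or> u = v' \<and> v = u' \<and> i = t - j"
  then show "subdiv_point t u v i = subdiv_point t u' v' j"
    using assms subdiv_point_swap[of j t u' v'] by auto
qed

lemma inner_subdiv_point_neq_replicate:
  assumes "u \<noteq> v" "0 < i" "i < t"
  shows "subdiv_point t u v i \<noteq> replicate_mset t w"
proof
  assume eq: "subdiv_point t u v i = replicate_mset t w"
  show False
    using arg_cong[OF eq, of set_mset] assms
    by (auto simp: subdiv_point_def doubleton_eq_iff split: if_splits)
qed

definition odd_frac_power :: "nat \<Rightarrow> nat \<Rightarrow> 'a pair_pre_digraph \<Rightarrow> 'a multiset pair_pre_digraph" where
  "odd_frac_power r s G = graph_power (2 * r + 1) (edge_subdivision (2 * s + 1) G)"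

text \<open>
  Only meaningful for non-bipartite \<open>G\<close>, where the odd girth is finite and the set is bounded.
\<close>

definition theta :: "'a pair_pre_digraph \<Rightarrow> real" where
  "theta G = Sup {real (2 * r + 1) / real (2 * s + 1) |r s.
     chromatic_number (odd_frac_power r s G) \<le> chromatic_number G \<and>
     ereal (real (2 * r + 1) / real (2 * s + 1)) < ereal_of_enat (odd_girth G)}"

definition circular_clique :: "nat \<Rightarrow> nat \<Rightarrow> nat pair_pre_digraph" where
  "circular_clique n d =
     \<lparr> pverts = {..<n},
       parcs = {(i, j). i < n \<and> j < n \<and>
                  int d \<le> \<bar>int i - int j\<bar> \<and> \<bar>int i - int j\<bar> \<le> int n - int d} \<rparr>"

definition circular_chromatic_number :: "'a pair_pre_digraph \<Rightarrow> real" where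
  "circular_chromatic_number G =
     (LEAST x. \<exists>n d. 1 \<le> d \<and> 2 * d \<le> n \<and> x = real n / real d \<and>
        (\<exists>f. graph_hom G (circular_clique n d) f))"

end

theory Submission
  imports Defs "HOL-Number_Theory.Cong"
begin

text \<open>
  A homomorphism to \<open>K\<^bsub>n/d\<^esub>\<close> places vertices on a circle of length \<open>1\<close> so that neighbours are within
  \<open>1/2 - d/n\<close> of being antipodal. Subdividing each edge into \<open>2s+1\<close> edges divides this deviation
  by \<open>2s+1\<close>, and walks of length \<open>2r+1\<close> multiply it by \<open>2r+1\<close>, while a deviation of at most
  \<open>1/6\<close> yields a three-colouring. Hence \<open>\<chi>\<^sub>c(G) < 3\<close> leaves room for a power with exponent
  larger than \<open>1\<close>. Conversely, a three-colouring of \<open>H\<^bsup>2r+1\<^esup>\<close> gives a homomorphism from \<open>H\<close> to the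
  cycle of length \<open>3(2r+1)\<close>; for \<open>H = S\<^bsub>2s+1\<^esub>(G)\<close> this maps \<open>G\<close> to the \<open>(2s+1)\<close>-th power of that
  cycle, which is a circular clique with \<open>n/d = (6r+3)/(3r+1-s)\<close>, less than \<open>3\<close> if \<open>s < r\<close>.
\<close>

section \<open>Walks as relation powers, colourings, parity of closed walks\<close>

lemma graph_power_arcs:
  "(u, v) \<in> parcs (graph_power k G) \<longleftrightarrow> u \<in> pverts G \<and> (u, v) \<in> parcs G ^^ k"
proof -
  have "(u, v) \<in> parcs G ^^ length p"
    if "pre_digraph.cas (with_proj G) u p v" "set p \<subseteq> parcs G" for p
    using that
  proof (induction p arbitrary: u)
    case Nil
    then show ?case by (simp add: pre_digraph.cas.simps)
  next
    case (Cons e p)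
    then have "e = (u, snd e)" "(snd e, v) \<in> parcs G ^^ length p" "e \<in> parcs G"
      by (auto simp: pre_digraph.cas.simps prod_eq_iff)
    then show ?case by (metis relpow_Suc_I2 length_Cons)
  qed
  moreover have "\<exists>p. pre_digraph.cas (with_proj G) u p v \<and> set p \<subseteq> parcs G \<and> length p = k"
    if "(u, v) \<in> parcs G ^^ k"
    using that
  proof (induction k arbitrary: u)
    case 0
    then show ?case by (auto intro: exI[of _ "[]"] simp: pre_digraph.cas.simps)
  next
    case (Suc k)
    then obtain w where w: "(u, w) \<in> parcs G" "(w, v) \<in> parcs G ^^ k"
      by (meson relpow_Suc_D2)
    with Suc.IH obtain p where "pre_digraph.cas (with_proj G) w p v" "set p \<subseteq> parcs G" "length p = k"
      by blast
    with w show ?case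
      by (intro exI[of _ "(u, w) # p"]) (auto simp: pre_digraph.cas.simps)
  qed
  ultimately show ?thesis
    by (auto simp: graph_power_def pre_digraph.awalk_def)
qed

lemma colourable_mono: "colourable m G \<Longrightarrow> m \<le> n \<Longrightarrow> colourable n G"
  unfolding colourable_def by (meson lessThan_subset_iff order_trans)

lemma Inf_enat_mem:
  fixes S :: "enat set"
  assumes "Inf S \<noteq> \<infinity>"
  shows "Inf S \<in> S"
proof -
  obtain a where "a \<in> S"
    using assms by (auto simp: Inf_enat_def split: if_splits)
  then show ?thesis
    unfolding Inf_enat_def by (auto intro: LeastI)
qed

lemma chromatic_number_le_iff: "chromatic_number G \<le> enat n \<longleftrightarrow> colourable n G"
proof
  assume le: "chromatic_number G \<le> enat n"
  let ?S = "{enat n |n. colourable n G}"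
  have "chromatic_number G \<noteq> \<infinity>"
    using le by (cases "chromatic_number G") auto
  then have "chromatic_number G \<in> ?S"
    unfolding chromatic_number_def by (rule Inf_enat_mem)
  then obtain m where "colourable m G" "m \<le> n"
    using le by auto
  then show "colourable n G" by (rule colourable_mono)
next
  assume "colourable n G"
  then show "chromatic_number G \<le> enat n"
    unfolding chromatic_number_def by (auto intro: Inf_lower)
qed

lemma relpow_trans: "(u, v) \<in> R ^^ i \<Longrightarrow> (v, w) \<in> R ^^ j \<Longrightarrow> (u, w) \<in> R ^^ (i + j)"
  by (auto simp: relpow_add)

lemma sym_relpow:
  assumes "sym R"
  shows "sym (R ^^ k)"
proof (induction k)
  case (Suc k)
  show ?case
  proof (rule symI)
    fix x y assume "(x, y) \<in> R ^^ Suc k"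
    then obtain z where "(x, z) \<in> R ^^ k" "(z, y) \<in> R" by auto
    then have "(z, x) \<in> R ^^ k" "(y, z) \<in> R" using Suc assms by (auto dest: symD)
    then show "(y, x) \<in> R ^^ Suc k" by (rule relpow_Suc_I2[rotated])
  qed
qed (simp add: sym_def)

text \<open>The last arc of the walk is traversed back and forth \<open>m\<close> times;
  \<open>0 < k\<close> provides such an arc.\<close>

lemma relpow_add2:
  assumes "sym R" "(u, v) \<in> R ^^ k" "0 < k"
  shows "(u, v) \<in> R ^^ (k + 2 * m)"
proof (induction m)
  case 0
  then show ?case using assms by simp
next
  case (Suc m)
  have "0 < k + 2 * m" using assms by simp
  then obtain l where l: "k + 2 * m = Suc l" by (metis Suc_pred)
  with Suc obtain w where w: "(u, w) \<in> R ^^ l" "(w, v) \<in> R" by auto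
  then have "(v, w) \<in> R" using assms by (auto dest: symD)
  with w l show ?case by auto
qed

text \<open>The colour of a vertex records whether an even walk from the root of its component
  reaches it. Even walks to both ends of an arc would close up with that arc to an odd walk; and
  since some walk reaches one end, at least one end is reached evenly.\<close>

lemma two_colourable_if_no_odd_closed_walk:
  assumes sym: "sym (parcs G)"
    and no_odd: "\<And>u m. (u, u) \<in> parcs G ^^ m \<Longrightarrow> even m"
  shows "colourable 2 G"
proof -
  define root where "root v = (SOME w. (v, w) \<in> (parcs G)\<^sup>*)" for v
  define c :: "_ \<Rightarrow> nat" where
    "c v = (if \<exists>k. even k \<and> (root v, v) \<in> parcs G ^^ k then 0 else 1)" for v
  have c_neq: "c u \<noteq> c v" if uv: "(u, v) \<in> parcs G" for u v
  proof -
    have symr: "sym ((parcs G)\<^sup>*)"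
      using sym by (rule sym_rtrancl)
    have vu: "(v, u) \<in> parcs G" using sym uv by (auto dest: symD)
    \<comment> \<open>Adjacent vertices reach the same vertices, so \<open>SOME\<close> picks the
      same root for both.\<close>
    have "(u, w) \<in> (parcs G)\<^sup>* \<longleftrightarrow> (v, w) \<in> (parcs G)\<^sup>*" for w
      using uv vu by (meson converse_rtrancl_into_rtrancl)
    then have root: "root u = root v" by (simp add: root_def)
    have "(u, root u) \<in> (parcs G)\<^sup>*"
      unfolding root_def by (rule someI[of _ u]) simp
    then have "(root u, u) \<in> (parcs G)\<^sup>*" using symr by (auto dest: symD)
    then obtain k where k: "(root u, u) \<in> parcs G ^^ k"
      by (auto simp: rtrancl_power)
    have parity: False if "(root u, u) \<in> parcs G ^^ i" "(root u, v) \<in> parcs G ^^ j" "even i" "even j"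
      for i j
    proof -
      have "(v, root u) \<in> parcs G ^^ j" using that sym_relpow[OF sym] by (auto dest: symD)
      moreover have "(root u, v) \<in> parcs G ^^ Suc i" using that uv by auto
      ultimately have "(v, v) \<in> parcs G ^^ (j + Suc i)"
        by (rule relpow_trans)
      then show False using no_odd that by fastforce
    qed
    have "(root u, v) \<in> parcs G ^^ Suc k" using k uv by auto
    then have "(\<exists>i. even i \<and> (root u, u) \<in> parcs G ^^ i) \<or> (\<exists>j. even j \<and> (root u, v) \<in> parcs G ^^ j)"
      using k by (metis even_Suc)
    then show ?thesis using parity root by (auto simp: c_def)
  qed
  have "c ` pverts G \<subseteq> {..<2}" by (auto simp: c_def)
  with c_neq show ?thesis unfolding colourable_def by blast
qed

section \<open>Subdivisions and the bound given by odd closed walks\<close>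

lemma edge_subdivision_arcs:
  "(x, y) \<in> parcs (edge_subdivision t G) \<longleftrightarrow>
     (\<exists>u v i. (u, v) \<in> parcs G \<and> i < t \<and>
        (x = subdiv_point t u v i \<and> y = subdiv_point t u v (Suc i) \<or>
         x = subdiv_point t u v (Suc i) \<and> y = subdiv_point t u v i))"
  by (auto simp: edge_subdivision_def doubleton_eq_iff)

lemma sym_edge_subdivision: "sym (parcs (edge_subdivision t G))"
  unfolding sym_def edge_subdivision_arcs by blast

lemma replicate_in_edge_subdivision:
  "u \<in> pverts G \<Longrightarrow> replicate_mset t u \<in> pverts (edge_subdivision t G)"
  by (auto simp: edge_subdivision_def)

lemma edge_subdivision_arcs_in_verts:
  assumes "parcs G \<subseteq> pverts G \<times> pverts G"
  shows "parcs (edge_subdivision t G) \<subseteq> pverts (edge_subdivision t G) \<times> pverts (edge_subdivision t G)"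
proof -
  have point: "subdiv_point t u v i \<in> pverts (edge_subdivision t G)"
    if "(u, v) \<in> parcs G" "i \<le> t" for u v i
  proof (cases "0 < i \<and> i < t")
    case True
    then show ?thesis using that by (auto simp: edge_subdivision_def)
  next
    case False
    then have "i = 0 \<or> i = t" using that by auto
    then show ?thesis using that assms by (auto simp: edge_subdivision_def)
  qed
  show ?thesis
  proof (rule subrelI)
    fix x y assume "(x, y) \<in> parcs (edge_subdivision t G)"
    then obtain u v i where "(u, v) \<in> parcs G" "i < t"
      "x = subdiv_point t u v i \<and> y = subdiv_point t u v (Suc i) \<or>
       x = subdiv_point t u v (Suc i) \<and> y = subdiv_point t u v i"
      unfolding edge_subdivision_arcs by blast
    then show "(x, y) \<in> pverts (edge_subdivision t G) \<times> pverts (edge_subdivision t G)"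
      using point[of u v i] point[of u v "Suc i"] by auto
  qed
qed

lemma edge_subdivision_path:
  assumes "(u, v) \<in> parcs G"
  shows "(replicate_mset t u, replicate_mset t v) \<in> parcs (edge_subdivision t G) ^^ t"
proof -
  have "(subdiv_point t u v 0, subdiv_point t u v i) \<in> parcs (edge_subdivision t G) ^^ i"
    if "i \<le> t" for i
    using that
  proof (induction i)
    case 0
    then show ?case by simp
  next
    case (Suc i)
    then have "(subdiv_point t u v i, subdiv_point t u v (Suc i)) \<in> parcs (edge_subdivision t G)"
      unfolding edge_subdivision_arcs using assms
      by (intro exI[of _ u] exI[of _ v] exI[of _ i]) simp
    with Suc show ?case by auto
  qed
  from this[of t] show ?thesis by simp
qed

lemma edge_subdivision_walk:
  "(u, v) \<in> parcs G ^^ m \<Longrightarrow>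
     (replicate_mset t u, replicate_mset t v) \<in> parcs (edge_subdivision t G) ^^ (t * m)"
proof (induction m arbitrary: v)
  case 0
  then show ?case by simp
next
  case (Suc m)
  then obtain w where w: "(u, w) \<in> parcs G ^^ m" "(w, v) \<in> parcs G" by auto
  show ?case
    using relpow_trans[OF Suc.IH[OF w(1)] edge_subdivision_path[OF w(2), of t]]
    by (simp add: add.commute)
qed

text \<open>Subdivision turns the closed walk into one of odd length \<open>m * (2 * s + 1)\<close>.
  If \<open>2 * r + 1\<close> were at least that large, padding would give a closed walk of length
  \<open>2 * r + 1\<close>, hence a loop in the power.\<close>

lemma colourable_odd_frac_power_less:
  assumes u: "u \<in> pverts G" "(u, u) \<in> parcs G ^^ m" "odd m"
    and col: "colourable n (odd_frac_power r s G)"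
  shows "2 * r + 1 < m * (2 * s + 1)"
proof (rule ccontr)
  let ?t = "2 * s + 1" and ?H = "edge_subdivision (2 * s + 1) G"
  assume "\<not> 2 * r + 1 < m * ?t"
  moreover have "odd (?t * m)" using u by simp
  ultimately have "even (2 * r + 1 - ?t * m)" "?t * m \<le> 2 * r + 1"
    by (simp_all add: mult.commute)
  then obtain l where l: "2 * r + 1 = ?t * m + 2 * l"
    by (metis dvdE le_add_diff_inverse)
  have "(replicate_mset ?t u, replicate_mset ?t u) \<in> parcs ?H ^^ (?t * m)"
    using u(2) by (rule edge_subdivision_walk)
  then have "(replicate_mset ?t u, replicate_mset ?t u) \<in> parcs ?H ^^ (2 * r + 1)"
    unfolding l using odd_pos[OF \<open>odd (?t * m)\<close>] by (rule relpow_add2[OF sym_edge_subdivision])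
  then have "(replicate_mset ?t u, replicate_mset ?t u) \<in> parcs (odd_frac_power r s G)"
    using replicate_in_edge_subdivision[OF u(1)] unfolding odd_frac_power_def graph_power_arcs
    by (rule conjI[rotated])
  then show False using col unfolding colourable_def by blast
qed

text \<open>This makes the odd girth condition in \<open>theta\<close> a consequence of
  colourability: a shortest odd cycle is an odd closed walk.\<close>

lemma odd_frac_less_odd_girth:
  assumes col: "colourable n (odd_frac_power r s G)"
  shows "ereal (real (2 * r + 1) / real (2 * s + 1)) < ereal_of_enat (odd_girth G)"
proof (cases "odd_girth G")
  case (enat g)
  let ?S = "{enat (length p) |p. pre_digraph.cycle (with_proj G) p \<and> odd (length p)}"
  have "odd_girth G \<noteq> \<infinity>"
    using enat by simp
  then have "odd_girth G \<in> ?S"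
    unfolding odd_girth_def by (rule Inf_enat_mem)
  then obtain p where p: "pre_digraph.cycle (with_proj G) p" "odd (length p)" "length p = g"
    using enat by auto
  then obtain u where "pre_digraph.awalk (with_proj G) u p u"
    by (auto simp: pre_digraph.cycle_def)
  then have "(u, u) \<in> parcs (graph_power g G)"
    using p by (auto simp: graph_power_def)
  then have "u \<in> pverts G" "(u, u) \<in> parcs G ^^ g" "odd g"
    using p(2,3) unfolding graph_power_arcs by blast+
  then have "2 * r + 1 < g * (2 * s + 1)"
    using col by (rule colourable_odd_frac_power_less)
  then have "real (2 * r + 1) < real g * real (2 * s + 1)"
    by (metis of_nat_less_iff of_nat_mult)
  then show ?thesis
    using enat by (simp add: divide_less_eq)
qed simp

section \<open>From a three-colouring of a power to a circular clique\<close>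

text \<open>Deviations \<open>e\<close> from the ideal step \<open>h\<close> add up along a walk. It
  is applied with \<open>h\<close> half of the circumference: once to a subdivided edge, once to the
  walks behind the arcs of a power.\<close>

lemma relpow_circular_drift:
  fixes p :: "'a \<Rightarrow> int"
  assumes step: "\<And>u v. (u, v) \<in> R \<Longrightarrow> \<exists>e. \<bar>e\<bar> \<le> B \<and> [p v - p u = h + e] (mod N)"
    and "(u, v) \<in> R ^^ k"
  shows "\<exists>e. \<bar>e\<bar> \<le> int k * B \<and> [p v - p u = int k * h + e] (mod N)"
  using assms(2)
proof (induction k arbitrary: v)
  case 0
  then show ?case by (intro exI[of _ 0]) simp
next
  case (Suc k)
  then obtain w where w: "(u, w) \<in> R ^^ k" "(w, v) \<in> R" by auto
  from Suc.IH[OF w(1)] obtain e where e: "\<bar>e\<bar> \<le> int k * B" "[p w - p u = int k * h + e] (mod N)"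
    by blast
  from step[OF w(2)] obtain e' where e': "\<bar>e'\<bar> \<le> B" "[p v - p w = h + e'] (mod N)"
    by blast
  have "[(p w - p u) + (p v - p w) = (int k * h + e) + (h + e')] (mod N)"
    using e e' by (intro cong_add)
  then have "[p v - p u = int (Suc k) * h + (e + e')] (mod N)"
    by (simp add: algebra_simps)
  moreover have "\<bar>e + e'\<bar> \<le> int (Suc k) * B"
    using e e' by (simp add: algebra_simps)
  ultimately show ?case by blast
qed

text \<open>
  For a three-colouring \<open>c\<close> of the \<open>(2r+1)\<close>-th power, let \<open>A i u\<close> be the set of colours seen by
  walks of length \<open>i\<close> from \<open>u\<close>. For adjacent \<open>u\<close>, \<open>v\<close> and \<open>i \<le> r\<close> the sets \<open>A i u\<close> and \<open>A i v\<close> are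
  disjoint, so \<open>A 0 u, A 1 u, \<dots>\<close> alternates between two single colours until the third colour
  appears at index \<open>J u\<close>. Thus \<open>u\<close> has one of \<open>6r + 3\<close> states: its colour, the colour of its
  neighbours (void if \<open>J u = 1\<close>) and \<open>J u \<le> r + 1\<close>. Around the cycle, each colour class is an arc
  of \<open>2r + 1\<close> states; \<open>x\<close> is the distance to its centre, obtained by inverting
  \<open>J = min (2x + 1) (2(r + 1 - x))\<close>, and \<open>\<sigma>\<close> is the side of the centre.
\<close>

lemma three_colouring_of_power_gives_cycle_map:
  fixes c :: "'a \<Rightarrow> nat" and r :: nat
  assumes sym: "sym R" and r: "0 < r"
    and range: "\<And>u v. (u, v) \<in> R \<Longrightarrow> c u < 3"
    and proper: "\<And>u v. (u, v) \<in> R ^^ (2 * r + 1) \<Longrightarrow> c u \<noteq> c v"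
  obtains p :: "'a \<Rightarrow> int"
  where "\<And>u v. (u, v) \<in> R \<Longrightarrow> \<exists>m. \<bar>m\<bar> = 1 \<and> [2 * (p v - p u) = m] (mod (6 * int r + 3))"
proof -
  define A where "A i u = {c w |w. (u, w) \<in> R ^^ i}" for i u
  define J where "J u = (LEAST i. i = r + 1 \<or> 2 \<le> card (A i u))" for u
  define x :: "nat \<Rightarrow> int" where
    "x j = (if odd j then int (j div 2) else int r + 1 - int (j div 2))" for j
  define \<sigma> :: "'a \<Rightarrow> int" where "\<sigma> u = (if (c u + 2) mod 3 \<in> A 1 u then 1 else -1)" for u
  define p where "p u = (2 * int r + 1) * int (c u) + \<sigma> u * x (J u)" for u

  have symD': "(v, u) \<in> R" if "(u, v) \<in> R" for u v
    using sym that by (auto dest: symD)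
  have sympow: "(v, u) \<in> R ^^ k" if "(u, v) \<in> R ^^ k" for u v k
    using sym_relpow[OF sym] that by (auto dest: symD)
  have A_sub: "A i u \<subseteq> A (Suc i) v" if "(u, v) \<in> R" for i u v
    using symD'[OF that] unfolding A_def by (blast intro: relpow_Suc_I2)
  have A_range: "A i u \<subseteq> {..<3}" if "(u, v) \<in> R" for i u v
  proof
    fix a assume "a \<in> A i u"
    then obtain w where w: "a = c w" "(u, w) \<in> R ^^ i" by (auto simp: A_def)
    have "\<exists>w'. (w, w') \<in> R"
    proof (cases i)
      case 0
      then show ?thesis using w that by auto
    next
      case (Suc j)
      then show ?thesis using w by (meson relpow_Suc_E symD')
    qed
    then show "a \<in> {..<3}" using range w by auto
  qed
  have fin: "finite (A i u)" if "(u, v) \<in> R" for i u v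
    using finite_subset[OF A_range[OF that]] by simp
  \<comment> \<open>Two walks of length \<open>i\<close> joined by the arc \<open>uv\<close> form a
    walk of length \<open>2 * i + 1\<close>, which can be padded to
    \<open>2 * r + 1\<close>.\<close>
  have A_disj: "A i u \<inter> A i v = {}" if uv: "(u, v) \<in> R" and i: "i \<le> r" for i u v
  proof -
    have "c a \<noteq> c b" if "(u, a) \<in> R ^^ i" "(v, b) \<in> R ^^ i" for a b
    proof -
      have "(u, b) \<in> R ^^ Suc i" using uv that by (meson relpow_Suc_I2)
      then have "(a, b) \<in> R ^^ (i + Suc i)"
        using sympow[OF that(1)] by (auto intro: relpow_trans simp del: relpow.simps add_Suc_right)
      then have "(a, b) \<in> R ^^ (i + Suc i + 2 * (r - i))"
        using relpow_add2[OF sym] by blast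
      moreover have "i + Suc i + 2 * (r - i) = 2 * r + 1" using i by simp
      ultimately show ?thesis using proper by metis
    qed
    then show ?thesis by (auto simp: A_def)
  qed
  have J_prop: "J u = r + 1 \<or> 2 \<le> card (A (J u) u)" for u
    unfolding J_def by (rule LeastI[of _ "r + 1"]) simp
  have J_le: "J u \<le> i" if "2 \<le> card (A i u)" for i u
    unfolding J_def using that by (intro Least_le) simp
  have J_le': "J u \<le> r + 1" for u
    unfolding J_def by (intro Least_le) simp
  have A0: "A 0 u = {c u}" for u
    by (auto simp: A_def)
  have J_pos: "0 < J u" for u
    using J_prop[of u] A0[of u] by (cases "J u = 0") auto
  have J_step: "J v \<le> J u + 1" if uv: "(u, v) \<in> R" for u v
  proof (cases "J u = r + 1")
    case True
    then show ?thesis using J_le'[of v] by simp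
  next
    case False
    then have "2 \<le> card (A (J u) u)" using J_prop by blast
    also have "\<dots> \<le> card (A (Suc (J u)) v)"
      using A_sub[OF uv] fin[OF symD'[OF uv]] by (intro card_mono)
    finally show ?thesis using J_le by simp
  qed
  \<comment> \<open>Two disjoint sets of at least two colours each do not fit into three
    colours.\<close>
  have J_neq: "J u \<noteq> J v" if uv: "(u, v) \<in> R" and "J u \<le> r" for u v
  proof
    assume eq: "J u = J v"
    have "2 \<le> card (A (J u) u)" "2 \<le> card (A (J u) v)"
      using J_prop[of u] J_prop[of v] that eq by auto
    moreover have "card (A (J u) u \<union> A (J u) v) = card (A (J u) u) + card (A (J u) v)"
      using A_disj[OF that] fin[OF uv] fin[OF symD'[OF uv]] by (intro card_Un_disjoint)
    moreover have "card (A (J u) u \<union> A (J u) v) \<le> card {..<3::nat}"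
      using A_range[OF uv] A_range[OF symD'[OF uv]] by (intro card_mono) auto
    ultimately show False by simp
  qed
  have A1: "A 1 v = {c u}" if uv: "(u, v) \<in> R" and "2 \<le> J v" for u v
  proof -
    have "c u \<in> A 1 v" using symD'[OF uv] by (auto simp: A_def)
    moreover have "card (A 1 v) \<le> Suc 0"
      using J_le[of 1 v] that by (cases "2 \<le> card (A 1 v)") auto
    ultimately show ?thesis
      using fin[OF symD'[OF uv], of 1] by (auto simp: card_le_Suc0_iff_eq)
  qed
  have sgn: "\<sigma> v = (if c u = (c v + 2) mod 3 then 1 else -1)" if "(u, v) \<in> R" "2 \<le> J v" for u v
    using A1[OF that] unfolding \<sigma>_def by auto

  \<comment> \<open>As \<open>6 * r + 3\<close> is odd, 2 is invertible, so \<open>2 * p\<close> is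
    a position on the cycle, and arcs go to neighbouring positions. Both ends lie on the far sides
    of their colour centres, so \<tau> factors out of the distance.\<close>
  have main: "\<exists>m. \<bar>m\<bar> = 1 \<and> [2 * (p v - p u) = m] (mod (6 * int r + 3))"
    if uv: "(u, v) \<in> R" and le: "J u \<le> J v" for u v
  proof -
    have Jv: "J v = J u + 1 \<or> J u = r + 1 \<and> J v = r + 1"
      using J_step[OF uv] J_neq[OF uv] J_le'[of u] J_le'[of v] le by linarith
    have "2 \<le> J v" using Jv J_pos[of u] r by auto
    define \<tau> where "\<tau> = \<sigma> v"
    have c3: "c u < 3" "c v < 3" "c u \<noteq> c v"
      using range[OF uv] range[OF symD'[OF uv]] A_disj[OF uv, of 0] by (auto simp: A0)
    then have "c u \<in> {0, 1, 2}" "c v \<in> {0, 1, 2}" by auto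
    then have "(int (c v) - int (c u) - \<tau>) mod 3 = 0 \<and> (\<tau> = 1 \<or> \<tau> = -1)
        \<and> (2 \<le> J u \<longrightarrow> \<sigma> u = - \<tau>)"
      using c3 sgn[OF uv \<open>2 \<le> J v\<close>] sgn[OF symD'[OF uv]] unfolding \<tau>_def by auto
    then have \<tau>: "\<tau> = 1 \<or> \<tau> = -1" and \<sigma>u: "2 \<le> J u \<Longrightarrow> \<sigma> u = - \<tau>"
      and "3 dvd int (c v) - int (c u) - \<tau>" by auto
    then obtain k where k: "int (c v) = int (c u) + \<tau> + 3 * k"
      by (metis add.commute diff_add_cancel diff_diff_eq dvdE)
    have xu: "\<sigma> u * x (J u) = - \<tau> * x (J u)"
    proof (cases "2 \<le> J u")
      case False
      \<comment> \<open>Here \<sigma> has no meaning at \<open>u\<close>, but \<open>u\<close> sits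
        at the centre of its colour arc, \<open>x 1 = 0\<close>.\<close>
      then have "J u = 1" using J_pos[of u] by simp
      then show ?thesis by (simp add: x_def)
    qed (simp add: \<sigma>u)
    \<comment> \<open>The two possible sums make \<open>2 * (2 * r + 1 + sum)\<close> differ from
      \<open>6 * r + 3\<close> by exactly 1.\<close>
    have x_sum: "x (J u) + x (J v) = int r \<or> x (J u) + x (J v) = int r + 1"
    proof (cases "even (J u)")
      case True
      then obtain a where "J u = 2 * a" by (elim evenE)
      with Jv show ?thesis by (auto simp: x_def)
    next
      case False
      then obtain a where "J u = 2 * a + 1" by (elim oddE)
      with Jv show ?thesis by (auto simp: x_def)
    qed
    have "2 * (p v - p u) = \<tau> * (4 * int r + 2 + 2 * (x (J u) + x (J v))) + (6 * int r + 3) * (2 * k)"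
      unfolding p_def k xu \<tau>_def[symmetric] by (simp add: algebra_simps)
    then have "2 * (p v - p u) - \<tau> * (4 * int r + 2 + 2 * (x (J u) + x (J v)) - (6 * int r + 3))
        = (6 * int r + 3) * (2 * k + \<tau>)"
      by (simp add: algebra_simps)
    then have "[2 * (p v - p u) = \<tau> * (4 * int r + 2 + 2 * (x (J u) + x (J v)) - (6 * int r + 3))] (mod (6 * int r + 3))"
      unfolding cong_iff_dvd_diff by (metis dvd_triv_left)
    moreover have "\<bar>\<tau> * (4 * int r + 2 + 2 * (x (J u) + x (J v)) - (6 * int r + 3))\<bar> = 1"
      using \<tau> x_sum by auto
    ultimately show ?thesis by blast
  qed
  have "\<exists>m. \<bar>m\<bar> = 1 \<and> [2 * (p v - p u) = m] (mod (6 * int r + 3))" if uv: "(u, v) \<in> R" for u v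
  proof (cases "J u \<le> J v")
    case True
    then show ?thesis using main uv by blast
  next
    case False
    then obtain m where m: "\<bar>m\<bar> = 1" "[2 * (p u - p v) = m] (mod (6 * int r + 3))"
      using main[OF symD'[OF uv]] by auto
    have "[- (2 * (p u - p v)) = - m] (mod (6 * int r + 3))"
      using m(2) by (simp only: cong_minus_minus_iff)
    then have "[2 * (p v - p u) = - m] (mod (6 * int r + 3))"
      by (simp only: mult_minus_right[symmetric] minus_diff_eq)
    then show ?thesis using m(1) by (intro exI[of _ "- m"]) simp
  qed
  then show thesis by (rule that)
qed

text \<open>Doubled positions live on a circle of circumference \<open>2 * N\<close>, where each arc
  of the subdivision makes half a turn up to 1. A whole edge then deviates by at most
  \<open>2 * s + 1\<close>, and \<open>N - (2 * s + 1)\<close> is twice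
  \<open>3 * r + 1 - s\<close>.\<close>

lemma circular_clique_hom_if_power_three_colourable:
  assumes wf: "parcs G \<subseteq> pverts G \<times> pverts G" and "s < r"
    and col: "colourable 3 (odd_frac_power r s G)"
  shows "\<exists>f. graph_hom G (circular_clique (6 * r + 3) (3 * r + 1 - s)) f"
proof -
  let ?t = "2 * s + 1" and ?H = "edge_subdivision (2 * s + 1) G"
  define N where "N = 6 * int r + 3"
  obtain c :: "'a multiset \<Rightarrow> nat" where c: "c ` pverts ?H \<subseteq> {..<3}"
    "\<And>x y. (x, y) \<in> parcs (odd_frac_power r s G) \<Longrightarrow> c x \<noteq> c y"
    using col unfolding colourable_def by (auto simp: odd_frac_power_def graph_power_def)
  note H_wf = edge_subdivision_arcs_in_verts[OF wf, of ?t]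
  have range: "c x < 3" if "(x, y) \<in> parcs ?H" for x y
    using H_wf c(1) that by blast
  have proper: "c x \<noteq> c y" if xy: "(x, y) \<in> parcs ?H ^^ (2 * r + 1)" for x y
  proof -
    have "(x, y) \<in> parcs ?H ^^ Suc (2 * r)" using xy by simp
    then obtain z where "(x, z) \<in> parcs ?H" by (meson relpow_Suc_D2)
    then have "x \<in> pverts ?H" using H_wf by blast
    then have "(x, y) \<in> parcs (odd_frac_power r s G)"
      using xy unfolding odd_frac_power_def graph_power_arcs by (rule conjI)
    then show ?thesis by (rule c(2))
  qed
  obtain p :: "'a multiset \<Rightarrow> int" where p:
    "\<And>x y. (x, y) \<in> parcs ?H \<Longrightarrow> \<exists>m. \<bar>m\<bar> = 1 \<and> [2 * (p y - p x) = m] (mod N)"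
  proof (rule three_colouring_of_power_gives_cycle_map[OF sym_edge_subdivision _ range proper])
    show "0 < r" using \<open>s < r\<close> by simp
  qed (auto simp: N_def intro: that)
  define f where "f u = nat (p (replicate_mset ?t u) mod N)" for u
  have N: "0 < N" "N = int (6 * r + 3)" by (auto simp: N_def)
  have f: "int (f u) = p (replicate_mset ?t u) mod N" "f u < 6 * r + 3" for u
    using N by (auto simp: f_def nat_less_iff)
  have "int (3 * r + 1 - s) \<le> \<bar>int (f u) - int (f v)\<bar> \<and>
        \<bar>int (f u) - int (f v)\<bar> \<le> int (6 * r + 3) - int (3 * r + 1 - s)"
    if uv: "(u, v) \<in> parcs G" for u v
  proof -
    \<comment> \<open>\<open>m\<close> and \<open>N\<close> are odd and the left side is even, so
      the multiple of \<open>N\<close> is odd; this lifts the congruence to modulus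
      \<open>2 * N\<close>.\<close>
    have step: "\<exists>e. \<bar>e\<bar> \<le> 1 \<and> [2 * p y - 2 * p x = N + e] (mod (2 * N))"
      if xy: "(x, y) \<in> parcs ?H" for x y
    proof -
      obtain m where m: "\<bar>m\<bar> = 1" "[2 * (p y - p x) = m] (mod N)"
        using p[OF xy] by blast
      then obtain l where l: "2 * (p y - p x) - m = N * l"
        by (auto simp: cong_iff_dvd_diff elim: dvdE)
      have "odd m" using m(1) by (cases "0 \<le> m") auto
      then have "odd (N * l)" unfolding l[symmetric] by simp
      then have "odd l" by simp
      then obtain l' where "l = 2 * l' + 1" by (elim oddE)
      with l have "2 * p y - 2 * p x - (N + m) = 2 * N * l'"
        by (simp add: algebra_simps)
      then have "[2 * p y - 2 * p x = N + m] (mod (2 * N))"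
        unfolding cong_iff_dvd_diff by (metis dvd_triv_left)
      then show ?thesis using m(1) by (intro exI[of _ m]) simp
    qed
    obtain e where e: "\<bar>e\<bar> \<le> int ?t * 1"
      "[2 * p (replicate_mset ?t v) - 2 * p (replicate_mset ?t u) = int ?t * N + e] (mod (2 * N))"
      using relpow_circular_drift[where p = "\<lambda>x. 2 * p x", OF step edge_subdivision_path[OF uv]]
      by blast
    define D where "D = int (f v) - int (f u)"
    have mods: "int (f w) = p (replicate_mset ?t w) - N * (p (replicate_mset ?t w) div N)" for w
      by (simp add: f(1) minus_mult_div_eq_mod)
    obtain k where
      k: "2 * p (replicate_mset ?t v) - 2 * p (replicate_mset ?t u) - (int ?t * N + e) = 2 * N * k"
      using e(2) by (auto simp: cong_iff_dvd_diff elim: dvdE)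
    \<comment> \<open>An odd number of half turns is one half turn; the bounds on \<open>D\<close>
      and \<open>e\<close> then leave only \<open>q = 0\<close> and \<open>q = -1\<close>, the two
      signs of \<open>D\<close>.\<close>
    obtain q where q: "2 * D = N + e + 2 * (N * q)"
    proof
      show "2 * D = N + e + 2 * (N * (k + int s
          - p (replicate_mset ?t v) div N + p (replicate_mset ?t u) div N))"
        unfolding D_def mods using k by (simp add: algebra_simps)
    qed
    have D: "\<bar>D\<bar> < N"
      using f(2)[of u] f(2)[of v] N(2) unfolding D_def by linarith
    have e3: "\<bar>e\<bar> < N" using e(1) \<open>s < r\<close> by (simp add: N_def)
    have "q < 1"
    proof (rule ccontr)
      assume "\<not> q < 1"
      then have "N * 1 \<le> N * q" using N(1) by (intro mult_left_mono) auto
      then show False using q D e3 by linarith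
    qed
    moreover have "-2 < q"
    proof (rule ccontr)
      assume "\<not> -2 < q"
      then have "N * q \<le> N * (-2)" using N(1) by (intro mult_left_mono) auto
      then show False using q D e3 by linarith
    qed
    ultimately have "q = 0 \<or> q = -1" by linarith
    then have "2 * D = N + e \<or> 2 * D = e - N" using q by auto
    then show ?thesis
      using e(1) \<open>s < r\<close> by (auto simp: D_def N_def of_nat_diff)
  qed
  then show ?thesis
    using f(2) unfolding graph_hom_def circular_clique_def by auto
qed

section \<open>From a circular clique below 3 to a three-colouring of a power\<close>

text \<open>
  Regard the vertices of \<open>K\<^bsub>n/d\<^esub>\<close> as points of a circle of circumference \<open>C = 2tn\<close>, so that
  adjacent ones are almost antipodal. Since \<open>t\<close> is odd, the \<open>t\<close> steps of a subdivided edge can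
  each make half a turn plus \<open>1/t\<close> of the deviation of that edge. The function \<open>g\<close> is the
  resulting position; its second summand counts the copies of the end with the larger value of
  \<open>f\<close>, which makes it independent of the direction of the edge.
\<close>

lemma power_three_colourable_if_circular_clique_hom:
  assumes sym: "sym (parcs G)" and hom: "graph_hom G (circular_clique n d) f"
    and n: "2 * d \<le> n" "n < 3 * d"
  shows "colourable 3 (odd_frac_power (n + 1) n G)"
proof -
  define t where "t = 2 * n + 1"
  define C where "C = 2 * int t * int n"
  define B where "B = int n - 2 * int d"
  define g :: "'a multiset \<Rightarrow> int" where
    "g M = (\<Sum>w\<in>#M. 2 * int (f w))
         + int n * (int t - 1) * int (size (filter_mset (\<lambda>w. \<exists>w'\<in>#M. f w' < f w) M))" for M
  let ?H = "edge_subdivision t G"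
  have C: "0 < C" using n by (auto simp: C_def t_def)
  have arc: "f u < n" "f v < n" "int d \<le> \<bar>int (f u) - int (f v)\<bar>" "\<bar>int (f u) - int (f v)\<bar> \<le> int n - int d"
    if "(u, v) \<in> parcs G" for u v
    using hom that by (auto simp: graph_hom_def circular_clique_def)

  have g_point: "[g (subdiv_point t u v i)
      = 2 * int t * int (f u) + int i * (int n * int t + (2 * (int (f v) - int (f u)) - int n))] (mod C)"
    if "f u < f v" "i \<le> t" for u v i
  proof -
    have sum: "(\<Sum>w\<in>#subdiv_point t u v i. 2 * int (f w))
        = 2 * int t * int (f u) + int i * (2 * (int (f v) - int (f u)))"
      using that by (simp add: subdiv_point_def of_nat_diff algebra_simps)
    have sz: "size (filter_mset (\<lambda>w. \<exists>w'\<in>#subdiv_point t u v i. f w' < f w) (subdiv_point t u v i))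
        = (if i < t then i else 0)"
    proof -
      have "filter_mset P (replicate_mset m a) = (if P a then replicate_mset m a else {#})"
        for P m and a :: 'a
        by (induction m) auto
      then show ?thesis using that by (auto simp: subdiv_point_def)
    qed
    \<comment> \<open>At \<open>i = t\<close> only one vertex is left and the count in
      \<open>g\<close> drops to 0. The error \<open>n * (t - 1) * t\<close> equals
      \<open>C * n\<close> because \<open>t - 1 = 2 * n\<close>, so it vanishes modulo
      \<open>C\<close>.\<close>
    have "g (subdiv_point t u v i) - (2 * int t * int (f u)
        + int i * (int n * int t + (2 * (int (f v) - int (f u)) - int n)))
        = (if i < t then 0 else - (C * int n))"
      using that unfolding g_def sum sz by (auto simp: C_def t_def algebra_simps)
    then show ?thesis unfolding cong_iff_dvd_diff by auto
  qed

  have half_turn: "[int n * int t + e = - (int n * int t + - e)] (mod C)" for e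
    by (simp add: cong_iff_dvd_diff C_def)

  have step0: "\<exists>e. \<bar>e\<bar> \<le> B \<and> [g (subdiv_point t u v (Suc i)) - g (subdiv_point t u v i) = int n * int t + e] (mod C)"
    if uv: "(u, v) \<in> parcs G" "f u < f v" and i: "i < t" for u v i
  proof -
    \<comment> \<open>On the circle scaled by \<open>2 * t\<close> the edge deviates from a half
      turn by \<open>t * e\<close>; each of its \<open>t\<close> steps takes a share
      \<open>e\<close>.\<close>
    define e where "e = 2 * (int (f v) - int (f u)) - int n"
    have "[g (subdiv_point t u v (Suc i)) - g (subdiv_point t u v i) =
       (2 * int t * int (f u) + int (Suc i) * (int n * int t + e))
       - (2 * int t * int (f u) + int i * (int n * int t + e))] (mod C)"
      using g_point[OF uv(2), of i] g_point[OF uv(2), of "Suc i"] i unfolding e_def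
      by (intro cong_diff) (simp_all only: Suc_leI less_imp_le)
    moreover have "\<bar>e\<bar> \<le> B" using arc[OF uv(1)] uv(2) by (auto simp: e_def B_def)
    ultimately show ?thesis by (intro exI[of _ e]) (simp add: algebra_simps)
  qed
  have swap: "\<exists>e. \<bar>e\<bar> \<le> B \<and> [g y - g x = int n * int t + e] (mod C)"
    if ex: "\<exists>e. \<bar>e\<bar> \<le> B \<and> [g x - g y = int n * int t + e] (mod C)" for x y
  proof -
    obtain e where e: "\<bar>e\<bar> \<le> B" "[g x - g y = int n * int t + e] (mod C)"
      using ex by blast
    have "[- (g x - g y) = - (int n * int t + e)] (mod C)"
      using e(2) by (simp only: cong_minus_minus_iff)
    moreover have "[int n * int t + - e = - (int n * int t + e)] (mod C)"
      using half_turn[of "- e"] by simp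
    ultimately have "[- (g x - g y) = int n * int t + - e] (mod C)"
      using cong_sym cong_trans by blast
    then show ?thesis using e(1) by (intro exI[of _ "- e"]) simp
  qed
  have step: "\<exists>e. \<bar>e\<bar> \<le> B \<and> [g y - g x = int n * int t + e] (mod C)"
    if xy: "(x, y) \<in> parcs ?H" for x y
  proof -
    obtain u v i where uv: "(u, v) \<in> parcs G" "i < t"
      "x = subdiv_point t u v i \<and> y = subdiv_point t u v (Suc i) \<or>
       x = subdiv_point t u v (Suc i) \<and> y = subdiv_point t u v i"
      using xy unfolding edge_subdivision_arcs by blast
    have "f u \<noteq> f v" using arc[OF uv(1)] n by auto
    then consider "f u < f v" | "f v < f u" by linarith
    then have "\<exists>e. \<bar>e\<bar> \<le> B \<and> [g (subdiv_point t u v (Suc i)) - g (subdiv_point t u v i) = int n * int t + e] (mod C)"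
    proof cases
      case 1
      then show ?thesis using step0 uv by blast
    next
      case 2
      have vu: "(v, u) \<in> parcs G" using sym uv(1) by (rule symD)
      have "subdiv_point t u v (Suc i) = subdiv_point t v u (t - Suc i)"
        "subdiv_point t u v i = subdiv_point t v u (Suc (t - Suc i))"
        using uv(2) subdiv_point_swap[of "Suc i" t u v] subdiv_point_swap[of i t u v]
        by (simp_all add: Suc_diff_Suc)
      then show ?thesis using step0[OF vu 2, of "t - Suc i"] uv(2) by (auto intro!: swap)
    qed
    then show ?thesis using uv(3) swap by blast
  qed

  \<comment> \<open>The colour classes are three arcs of a third of the circle each.\<close>
  define c where "c x = nat (3 * (g x mod C) div C)" for x
  have div_C: "3 * (g x mod C) div C < 3" "0 \<le> 3 * (g x mod C) div C" for x
  proof -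
    show "3 * (g x mod C) div C < 3"
    proof (rule ccontr)
      assume "\<not> 3 * (g x mod C) div C < 3"
      then have "C * 3 \<le> C * (3 * (g x mod C) div C)" using C by (intro mult_left_mono) auto
      also have "\<dots> \<le> 3 * (g x mod C)"
        using C pos_mod_sign[of C "3 * (g x mod C)"] mult_div_mod_eq[of C "3 * (g x mod C)"] by linarith
      finally show False using C pos_mod_bound[of C "g x"] by linarith
    qed
  qed (use C in \<open>simp add: pos_imp_zdiv_nonneg_iff\<close>)
  have "c x \<noteq> c y" if xy: "(x, y) \<in> parcs ?H ^^ (t + 2)" for x y
  proof
    assume "c x = c y"
    then have same: "3 * (g x mod C) div C = 3 * (g y mod C) div C"
      unfolding c_def using div_C(2) by (simp only: eq_nat_nat_iff)
    obtain e where e: "\<bar>e\<bar> \<le> int (t + 2) * B" "[g y - g x = int (t + 2) * (int n * int t) + e] (mod C)"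
      using relpow_circular_drift[where p = g, OF step xy] by blast
    \<comment> \<open>From \<open>n < 3 * d\<close> follows \<open>3 * B \<le> n - 1\<close>, and
      \<open>t = 2 * n + 1\<close> is large enough that two extra steps keep the total deviation
      within a sixth of the circle.\<close>
    have "3 * (int (t + 2) * B) \<le> int t * int n"
    proof -
      have "int (t + 2) * (3 * B) \<le> int (t + 2) * (int n - 1)"
        using n by (intro mult_left_mono) (auto simp: B_def)
      also have "\<dots> \<le> int t * int n" by (simp add: t_def algebra_simps)
      finally show ?thesis by (simp add: algebra_simps)
    qed
    with e(1) have e3: "3 * \<bar>e\<bar> \<le> int t * int n" by linarith
    define D where "D = g y mod C - g x mod C"
    have "[D = g y - g x] (mod C)"
      by (simp add: D_def cong_def mod_diff_eq)
    with e(2) obtain k where k: "D - (int (t + 2) * (int n * int t) + e) = C * k"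
      by (metis cong_iff_dvd_diff cong_trans dvdE)
    obtain q where q: "D = int n * int t + e + 2 * (int n * int t) * q"
    proof
      show "D = int n * int t + e + 2 * (int n * int t) * (k + int n + 1)"
        using k by (simp add: C_def t_def algebra_simps)
    qed
    have "3 * \<bar>D\<bar> < C"
    proof -
      have close: "3 * \<bar>b - a\<bar> < C"
        if "3 * a = z + a'" "3 * b = z + b'" "0 \<le> a'" "a' < C" "0 \<le> b'" "b' < C"
        for a b z a' b' :: int
        using that by (simp add: abs_if)
      have "3 * (g x mod C) = C * (3 * (g x mod C) div C) + 3 * (g x mod C) mod C"
        "3 * (g y mod C) = C * (3 * (g y mod C) div C) + 3 * (g y mod C) mod C"
        by simp_all
      moreover have "0 \<le> 3 * (g x mod C) mod C" "3 * (g x mod C) mod C < C"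
        "0 \<le> 3 * (g y mod C) mod C" "3 * (g y mod C) mod C < C"
        using C by simp_all
      ultimately show ?thesis unfolding D_def same by (rule close)
    qed
    define L where "L = int n * int t"
    have CL: "C = 2 * L" "3 * \<bar>e\<bar> \<le> L" "D = L + e + 2 * (L * q)"
      using q e3 by (simp_all add: C_def L_def algebra_simps)
    \<comment> \<open>\<open>D\<close> is half a turn up to a sixth of the circle, so the points are
      at least \<open>C / 3\<close> apart, while points of one arc are closer than that.\<close>
    show False
    proof (cases "0 \<le> q")
      case True
      then have "0 \<le> L * q" by (simp add: L_def)
      then show False using CL \<open>3 * \<bar>D\<bar> < C\<close> by linarith
    next
      case False
      then have "L * q \<le> L * (-1)" by (intro mult_left_mono) (auto simp: L_def)
      then show False using CL \<open>3 * \<bar>D\<bar> < C\<close> by linarith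
    qed
  qed
  moreover have "c x < 3" for x
    using div_C[of x] by (simp add: c_def nat_less_iff)
  moreover have "t = 2 * n + 1" "t + 2 = 2 * (n + 1) + 1" by (simp_all add: t_def)
  ultimately show ?thesis
    unfolding colourable_def odd_frac_power_def graph_power_arcs
    by (intro exI[of _ c]) (auto simp del: relpow.simps)
qed

section \<open>Maps between circular cliques and attainment of the minimum\<close>

lemma graph_hom_comp:
  "graph_hom G H f \<Longrightarrow> graph_hom H K h \<Longrightarrow> graph_hom G K (h \<circ> f)"
  unfolding graph_hom_def by (auto simp: image_subset_iff)

lemma circular_clique_hom_reduce:
  assumes "0 < g" "0 < n"
  shows "graph_hom (circular_clique (n * g) (d * g)) (circular_clique n d) (\<lambda>i. i div g)"
proof -
  have half: "int d \<le> int (j div g) - int (i div g) \<and> int (j div g) - int (i div g) \<le> int n - int d"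
    if "int (d * g) \<le> int j - int i" "int j - int i \<le> int (n * g) - int (d * g)" for i j
  proof -
    have "i + d * g \<le> j" "j + d * g \<le> i + n * g" using that by linarith+
    then have "(i + d * g) div g \<le> j div g" "(j + d * g) div g \<le> (i + n * g) div g"
      by (auto intro: div_le_mono)
    then show ?thesis using assms by simp
  qed
  have "i div g < n" if "i < n * g" for i
    using that assms by (simp add: less_mult_imp_div_less)
  moreover have "int d \<le> \<bar>int (i div g) - int (j div g)\<bar> \<and> \<bar>int (i div g) - int (j div g)\<bar> \<le> int n - int d"
    if "int (d * g) \<le> \<bar>int i - int j\<bar>" "\<bar>int i - int j\<bar> \<le> int (n * g) - int (d * g)" for i j
    using half[of i j] half[of j i] that div_le_mono[of i j g] div_le_mono[of j i g]
    by (cases "i \<le> j") auto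
  ultimately show ?thesis
    unfolding graph_hom_def circular_clique_def by auto
qed

text \<open>Rotation serves to move a vertex missed by a homomorphism to a prescribed place.\<close>

lemma circular_clique_rotate:
  assumes "k \<le> n" "0 < d"
  shows "graph_hom (circular_clique n d) (circular_clique n d) (\<lambda>i. (i + k) mod n)"
proof -
  have red: "int ((i + k) mod n) = (if i + k < n then int i + int k else int i + int k - int n)"
    if "i < n" for i
    using that assms by (auto simp: mod_if)
  show ?thesis
    using assms unfolding graph_hom_def circular_clique_def
    by (auto simp: red split: if_splits)
qed

text \<open>Deleting a vertex from \<open>K\<^bsub>n/d\<^esub>\<close>, with \<open>n\<close> and \<open>d\<close> coprime, allows a map to the
  lower Farey neighbour: \<open>i \<mapsto> \<lfloor>i d'/d\<rfloor>\<close> only fails on the arc from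
  \<open>(- n) mod d\<close> to \<open>n - d + (- n) mod d\<close>.\<close>

lemma circular_clique_hom_lower:
  assumes "n * d' = n' * d + 1" "0 < d" "d < n" "0 < d'"
    and hom: "graph_hom G (circular_clique n d) f"
    and miss: "x < n" "x \<notin> f ` pverts G"
    and wf: "parcs G \<subseteq> pverts G \<times> pverts G"
  shows "\<exists>h. graph_hom G (circular_clique n' d') h"
proof -
  define i0 where "i0 = nat ((- int n) mod int d)"
  define z where "z = n - d + i0"
  have i0: "i0 < d" "int i0 = (- int n) mod int d"
    using assms by (auto simp: i0_def nat_less_iff)
  \<comment> \<open>The rotation by \<open>k\<close> carries the missed vertex \<open>x\<close> to
    \<open>z\<close>, the end of the only arc on which the floor map fails.\<close>
  define k where "k = (if x \<le> z then z - x else z + n - x)"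
  have k: "k \<le> n" "(x + k) mod n = z"
    using i0 assms by (auto simp: k_def z_def mod_if)
  define f' where "f' u = (f u + k) mod n" for u
  have hom': "graph_hom G (circular_clique n d) f'"
    using graph_hom_comp[OF hom circular_clique_rotate[OF k(1) \<open>0 < d\<close>]]
    by (simp add: f'_def[abs_def] comp_def)
  have miss': "f' u \<noteq> z" if "u \<in> pverts G" for u
  proof
    assume "f' u = z"
    then have "(f u + k) mod n = (x + k) mod n" using k by (simp add: f'_def)
    moreover have "f u < n" using hom that by (auto simp: graph_hom_def circular_clique_def)
    ultimately have "f u = x"
      using miss(1) k(1) by (auto simp: mod_if split: if_splits)
    then show False using miss(2) that by auto
  qed
  have lower: "d' \<le> j * d' div d - i * d' div d" if "i + d \<le> j" for i j
  proof -
    have "(i * d' + d' * d) div d \<le> j * d' div d"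
      using that by (intro div_le_mono) (metis add_mult_distrib mult.commute mult_le_mono1)
    then show ?thesis using \<open>0 < d\<close> by simp
  qed
  have upper: "j * d' div d + d' \<le> i * d' div d + n'" if ij: "j + d \<le> i + n" "j < n" "j \<noteq> z" for i j
  proof -
    have le: "j * d' + d' * d \<le> i * d' + n' * d + 1"
      using mult_le_mono1[OF ij(1), of d'] assms(1) by (simp add: algebra_simps)
    \<comment> \<open>A violation needs equality, so \<open>j + d = i + n\<close>, and
      \<open>d dvd i * d' + 1\<close>. As \<open>n\<close> inverts \<open>d'\<close> modulo
      \<open>d\<close>, this gives \<open>i = i0\<close> and \<open>j = z\<close>. Without the
      divisibility the surplus 1 is lost in the floor.\<close>
    have "j * d' + d' * d \<le> i * d' + n' * d \<or> \<not> d dvd i * d' + 1"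
    proof (rule ccontr)
      assume neg: "\<not> ?thesis"
      then have eq: "j * d' + d' * d = i * d' + n' * d + 1" and dvd: "d dvd i * d' + 1"
        using le by auto
      have "(j + d) * d' = (i + n) * d'" using eq assms(1) by (simp add: algebra_simps)
      then have jd: "j + d = i + n" using \<open>0 < d'\<close> by simp
      have "int d dvd int n * (int i * int d' + 1)" using dvd
        by (metis dvd_mult int_dvd_int_iff of_nat_1 of_nat_add of_nat_mult)
      moreover have "int n * (int i * int d' + 1) = int i * (int n * int d') + int n"
        by (simp add: algebra_simps)
      moreover have "int n * int d' = int n' * int d + 1" using assms(1) by (metis of_nat_1 of_nat_add of_nat_mult)
      ultimately have "int d dvd int i * (int n' * int d + 1) + int n" by simp
      then have "int d dvd (int i + int n) + int d * (int i * int n')" by (simp add: algebra_simps)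
      then have "int d dvd int i - (- int n)" by (simp add: dvd_add_left_iff)
      then have "int i mod int d = int i0" unfolding i0(2) by (simp only: mod_eq_dvd_iff)
      moreover have "i < d" using jd ij(2) by linarith
      ultimately have "i = i0" by simp
      then show False using jd ij(3) \<open>d < n\<close> by (simp add: z_def)
    qed
    then have "(j * d' + d' * d) div d \<le> (i * d' + n' * d) div d"
    proof
      assume "\<not> d dvd i * d' + 1"
      then have "(i * d' + 1 + n' * d) div d = (i * d' + n' * d) div d"
        using \<open>0 < d\<close> by (simp add: div_Suc dvd_eq_mod_eq_0)
      then show ?thesis using div_le_mono[OF le, of d] by (simp add: algebra_simps)
    qed (rule div_le_mono)
    then show ?thesis using \<open>0 < d\<close> by simp
  qed
  have range: "j * d' div d < n'" if j: "j < n" "j \<noteq> z" for j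
  proof -
    \<comment> \<open>The index \<open>d - 1\<close> is the largest with floor value below
      \<open>d'\<close>.\<close>
    have "j * d' div d + d' \<le> (d - 1) * d' div d + n'"
      using upper[of j "d - 1"] j \<open>0 < d\<close> by simp
    moreover have "(d - 1) * d' div d < d'"
      using \<open>0 < d\<close> \<open>0 < d'\<close> by (simp add: div_less_iff_less_mult mult.commute)
    ultimately show ?thesis by linarith
  qed
  have arc: "int d' \<le> int (j * d' div d) - int (i * d' div d) \<and>
      int (j * d' div d) - int (i * d' div d) \<le> int n' - int d'"
    if "int d \<le> int j - int i" "int j - int i \<le> int n - int d" "j < n" "j \<noteq> z" for i j
  proof -
    have "i + d \<le> j" "j + d \<le> i + n" using that by linarith+
    with lower[of i j] upper[of j i] that show ?thesis
      using \<open>0 < d'\<close> by linarith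
  qed
  show ?thesis
  proof (intro exI)
    show "graph_hom G (circular_clique n' d') (\<lambda>u. f' u * d' div d)"
      unfolding graph_hom_def
    proof (intro conjI allI impI)
      show "(\<lambda>u. f' u * d' div d) ` pverts G \<subseteq> pverts (circular_clique n' d')"
        using hom' miss' range by (auto simp: graph_hom_def circular_clique_def image_subset_iff)
    next
      fix u v assume uv: "(u, v) \<in> parcs G"
      then have V: "u \<in> pverts G" "v \<in> pverts G" using wf by auto
      have a: "f' u < n" "f' v < n" "int d \<le> \<bar>int (f' u) - int (f' v)\<bar>"
        "\<bar>int (f' u) - int (f' v)\<bar> \<le> int n - int d"
        using hom' uv by (auto simp: graph_hom_def circular_clique_def)
      show "(f' u * d' div d, f' v * d' div d) \<in> parcs (circular_clique n' d')"
        using arc[of "f' u" "f' v"] arc[of "f' v" "f' u"] a miss' V range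
        by (cases "f' u \<le> f' v") (auto simp: circular_clique_def)
    qed
  qed
qed

text \<open>Descent on \<open>n\<close>: a common factor is cancelled; otherwise, for
  \<open>n\<close> above the number of vertices, some vertex is missed and the target can be
  replaced by its lower Farey neighbour.\<close>

lemma circular_clique_hom_bounded:
  assumes wf: "parcs G \<subseteq> pverts G \<times> pverts G" and fin: "finite (pverts G)"
    and "0 < d" "2 * d \<le> n" "graph_hom G (circular_clique n d) f"
  shows "\<exists>n' d' f'. 0 < d' \<and> 2 * d' \<le> n' \<and> n' \<le> max 2 (card (pverts G)) \<and>
           real n' / real d' \<le> real n / real d \<and> graph_hom G (circular_clique n' d') f'"
  using assms(3-)
proof (induction n arbitrary: d f rule: less_induct)
  case (less n)
  show ?case
  proof (cases "n \<le> max 2 (card (pverts G))")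
    case True
    then show ?thesis using less.prems by blast
  next
    case False
    then have n: "2 < n" "card (pverts G) < n" by auto
    have "\<exists>n' d' f'. n' < n \<and> 0 < d' \<and> 2 * d' \<le> n' \<and>
        real n' / real d' \<le> real n / real d \<and> graph_hom G (circular_clique n' d') f'"
    proof (cases "coprime n d")
      case False
      define g where "g = gcd n d"
      have g: "1 < g" using False less.prems n
        by (metis coprime_iff_gcd_eq_1 g_def gcd_pos_nat less_numeral_extra(3) nat_neq_iff less_one)
      obtain n' d' where eq: "n = n' * g" "d = d' * g"
        unfolding g_def by (metis dvdE gcd_dvd1 gcd_dvd2 mult.commute)
      have "0 < n'" "0 < d'" using less.prems n eq by (auto intro: gr0I)
      moreover have "n' < n" using \<open>0 < n'\<close> g eq(1) by simp
      moreover have "2 * d' \<le> n'" using less.prems(2) g unfolding eq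
        by (metis mult.assoc mult_le_cancel2 less_trans zero_less_one)
      moreover have "real n' / real d' = real n / real d" using g by (simp add: eq)
      moreover have "graph_hom G (circular_clique n' d') ((\<lambda>i. i div g) \<circ> f)"
        using graph_hom_comp[OF less.prems(3)[unfolded eq] circular_clique_hom_reduce] g \<open>0 < n'\<close> by auto
      ultimately show ?thesis by (metis order_refl)
    next
      case True
      have dn: "2 * d < n"
      proof (rule ccontr)
        assume "\<not> 2 * d < n"
        then have "n = d * 2" using less.prems by simp
        then show False using True n by simp
      qed
      \<comment> \<open>\<open>d'\<close> inverts \<open>n\<close> modulo \<open>d\<close>, which
        yields the Farey relation \<open>n * d' = n' * d + 1\<close>. For \<open>d = 1\<close> the
        residue would be 0, so 1 is taken instead.\<close>
      obtain d' where d': "0 < d'" "d' \<le> d" "[n * d' = 1] (mod d)"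
      proof (cases "d = 1")
        case True
        then show ?thesis using that[of 1] by simp
      next
        case False
        then have d1: "1 < d" using less.prems by simp
        obtain y where y: "[n * y = 1] (mod d)"
          using cong_solve_coprime_nat[OF True] by auto
        have "[n * (y mod d) = 1] (mod d)"
          using y by (simp add: cong_def mod_mult_right_eq)
        moreover have "0 < y mod d"
        proof (rule gr0I)
          assume "y mod d = 0"
          then show False using calculation d1 by (simp add: cong_def)
        qed
        moreover have "y mod d \<le> d" using d1 by simp
        ultimately show ?thesis using that by blast
      qed
      have "1 \<le> n * d'" using n d' by simp
      then have "d dvd n * d' - 1"
        using d'(3) by (meson cong_altdef_nat cong_sym)
      then obtain n' where "n * d' - 1 = d * n'" by (elim dvdE)
      then have n': "n * d' = n' * d + 1" using \<open>1 \<le> n * d'\<close> by (simp only: mult.commute)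
      have "n' * d < n * d"
        using n' mult_le_mono2[OF d'(2), of n] by linarith
      then have "n' < n" by simp
      \<comment> \<open>The surplus \<open>d'\<close> from \<open>2 * d < n\<close> pays for the 1
        in the Farey relation, so the new fraction stays at least 2.\<close>
      have "(2 * d') * d + d' \<le> n * d'"
        using dn mult_le_mono1[of "2 * d + 1" n d'] by (simp add: algebra_simps)
      then have "(2 * d') * d \<le> n' * d" using n' d'(1) by linarith
      then have "2 * d' \<le> n'" using less.prems(1) by simp
      have "real (n' * d) \<le> real (n * d')" using n' by linarith
      then have "real n' / real d' \<le> real n / real d"
        using d'(1) less.prems(1) by (simp add: field_simps)
      have "card (f ` pverts G) < card {..<n}"
        using n(2) card_image_le[OF fin, of f] by simp
      then obtain x where x: "x < n" "x \<notin> f ` pverts G"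
        by (metis card_mono finite_imageI fin leD lessThan_iff subsetI)
      then obtain h where "graph_hom G (circular_clique n' d') h"
        using circular_clique_hom_lower[OF n' less.prems(1) _ d'(1) less.prems(3) x wf] dn by auto
      then show ?thesis
        using \<open>n' < n\<close> \<open>2 * d' \<le> n'\<close> d'(1) \<open>real n' / real d' \<le> real n / real d\<close> by blast
    qed
    then show ?thesis using less.IH by (meson order_trans)
  qed
qed

text \<open>\<open>LEAST\<close> over the reals needs a minimum. The finitely many admissible
  fractions with numerator and denominator up to \<open>M\<close> contain a lower bound for each
  admissible value, so their \<open>Min\<close> is the least one.\<close>

lemma circular_chromatic_number_attained:
  assumes wf: "parcs G \<subseteq> pverts G \<times> pverts G" and fin: "finite (pverts G)"
    and "0 < d" "2 * d \<le> n" "graph_hom G (circular_clique n d) f"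
  shows "circular_chromatic_number G \<le> real n / real d"
    and "\<exists>n d f. 0 < d \<and> 2 * d \<le> n \<and> circular_chromatic_number G = real n / real d
           \<and> graph_hom G (circular_clique n d) f"
proof -
  define P where "P x \<longleftrightarrow> (\<exists>n d. 1 \<le> d \<and> 2 * d \<le> n \<and> x = real n / real d \<and>
        (\<exists>f. graph_hom G (circular_clique n d) f))" for x
  define M where "M = max 2 (card (pverts G))"
  define S where "S = {x. P x} \<inter> (\<lambda>(n, d). real n / real d) ` ({..M} \<times> {..M})"
  have dom: "\<exists>y\<in>S. y \<le> x" if Px: "P x" for x
  proof -
    obtain n d f where nd: "0 < d" "2 * d \<le> n" "x = real n / real d" "graph_hom G (circular_clique n d) f"
      using Px by (auto simp: P_def Suc_le_eq)
    obtain n' d' f' where nd': "0 < d'" "2 * d' \<le> n'" "n' \<le> M"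
      "real n' / real d' \<le> x" "graph_hom G (circular_clique n' d') f'"
      using circular_clique_hom_bounded[OF wf fin nd(1,2,4)] unfolding M_def nd(3) by blast
    then have "P (real n' / real d')" unfolding P_def by (auto simp: Suc_le_eq)
    moreover have "real n' / real d' \<in> (\<lambda>(n, d). real n / real d) ` ({..M} \<times> {..M})"
      using nd' by (intro image_eqI[of _ _ "(n', d')"]) auto
    ultimately show ?thesis using nd'(4) unfolding S_def by blast
  qed
  have Pnd: "P (real n / real d)" unfolding P_def using assms by (auto simp: Suc_le_eq)
  have S: "finite S" "S \<noteq> {}" using dom[OF Pnd] by (auto simp: S_def)
  have Min_le: "Min S \<le> x" if "P x" for x
    using dom[OF that] S(1) by (meson Min_le order_trans)
  have PMin: "P (Min S)" using Min_in[OF S] by (simp add: S_def)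
  have "(LEAST x. P x) = Min S"
    using PMin Min_le by (rule Least_equality)
  then have eq: "circular_chromatic_number G = Min S"
    unfolding circular_chromatic_number_def P_def .
  show "circular_chromatic_number G \<le> real n / real d"
    unfolding eq using Pnd by (rule Min_le)
  show "\<exists>n d f. 0 < d \<and> 2 * d \<le> n \<and> circular_chromatic_number G = real n / real d
           \<and> graph_hom G (circular_clique n d) f"
    using PMin unfolding eq P_def by (auto simp: Suc_le_eq)
qed

section \<open>The equivalence\<close>

text \<open>With exponent 1 the power is a copy of \<open>G\<close> on singleton multisets; this
  puts 1 into the set whose supremum is \<open>theta\<close>.\<close>

lemma colourable_odd_frac_power_0:
  assumes "colourable n G" "parcs G \<subseteq> pverts G \<times> pverts G"
  shows "colourable n (odd_frac_power 0 0 G)"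
proof -
  obtain c :: "'a \<Rightarrow> nat" where c: "c ` pverts G \<subseteq> {..<n}" "\<And>u v. (u, v) \<in> parcs G \<Longrightarrow> c u \<noteq> c v"
    using assms unfolding colourable_def by blast
  define c' where "c' M = c (THE u. M = replicate_mset 1 u)" for M
  have c': "c' {#u#} = c u" for u
    by (simp add: c'_def)
  show ?thesis
    unfolding colourable_def odd_frac_power_def graph_power_arcs
  proof (intro exI[of _ c'] conjI allI impI)
    show "c' ` pverts (graph_power (2 * 0 + 1) (edge_subdivision (2 * 0 + 1) G)) \<subseteq> {..<n}"
      using c(1) by (auto simp: graph_power_def edge_subdivision_def c' image_subset_iff)
  next
    fix x y
    assume "x \<in> pverts (edge_subdivision (2 * 0 + 1) G) \<and>
      (x, y) \<in> parcs (edge_subdivision (2 * 0 + 1) G) ^^ (2 * 0 + 1)"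
    then have "(x, y) \<in> parcs (edge_subdivision 1 G)" by simp
    then show "c' x \<noteq> c' y"
      unfolding edge_subdivision_arcs using c(2) by (fastforce simp: subdiv_point_def c')
  qed
qed

lemma circular_clique_hom_if_colourable:
  assumes "colourable n G" "parcs G \<subseteq> pverts G \<times> pverts G"
  shows "\<exists>f. graph_hom G (circular_clique n 1) f"
proof -
  obtain c :: "'a \<Rightarrow> nat" where c: "c ` pverts G \<subseteq> {..<n}" "\<And>u v. (u, v) \<in> parcs G \<Longrightarrow> c u \<noteq> c v"
    using assms unfolding colourable_def by blast
  have "(c u, c v) \<in> parcs (circular_clique n 1)" if uv: "(u, v) \<in> parcs G" for u v
  proof -
    have "c u < n" "c v < n" using uv assms(2) c(1) by blast+
    then show ?thesis using c(2)[OF uv] by (auto simp: circular_clique_def)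
  qed
  then have "graph_hom G (circular_clique n 1) c"
    using c(1) by (auto simp: graph_hom_def circular_clique_def)
  then show ?thesis by blast
qed

lemma Sup_eq_iff_no_greater:
  fixes S :: "real set"
  assumes "a \<in> S" "bdd_above S"
  shows "Sup S = a \<longleftrightarrow> (\<forall>x\<in>S. x \<le> a)"
  using assms by (metis cSup_upper cSup_eq_maximum)

theorem theorem4p3:
  fixes G :: "'a pair_pre_digraph"
  assumes "pair_graph G"
    and "chromatic_number G = 3"
  shows "theta G = 1 \<longleftrightarrow> circular_chromatic_number G = 3"
proof -
  interpret pair_graph G by fact
  have wf: "parcs G \<subseteq> pverts G \<times> pverts G"
    using arc_fst_in_verts arc_snd_in_verts by force
  have sym: "sym (parcs G)"
    using pair_sym_arcs by (simp add: symmetric_def)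
  have \<chi>: "chromatic_number H \<le> chromatic_number G \<longleftrightarrow> colourable 3 H"
    for H :: "'a multiset pair_pre_digraph"
    using chromatic_number_le_iff[of H 3] assms(2) by (simp add: numeral_eq_enat)
  have col3: "colourable 3 G" and not_col2: "\<not> colourable 2 G"
    using chromatic_number_le_iff[of G 3] chromatic_number_le_iff[of G 2] assms(2)
    by (simp_all add: numeral_eq_enat)

  define S where "S = {real (2 * r + 1) / real (2 * s + 1) |r s. colourable 3 (odd_frac_power r s G)}"
  have theta: "theta G = Sup S"
    unfolding theta_def S_def \<chi> using odd_frac_less_odd_girth by (metis (no_types, lifting))
  \<comment> \<open>An odd closed walk bounds the exponents, so that \<open>Sup\<close> on the reals
    is a genuine supremum.\<close>
  obtain u m where um: "(u, u) \<in> parcs G ^^ m" "odd m"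
    using two_colourable_if_no_odd_closed_walk[OF sym] not_col2 by blast
  obtain l where "m = Suc l" using um(2) by (cases m) auto
  with um(1) obtain v where "(u, v) \<in> parcs G" by (meson relpow_Suc_D2)
  then have u: "u \<in> pverts G" using wf by blast
  have "x \<le> real m" if "x \<in> S" for x
  proof -
    obtain r s where rs: "x = real (2 * r + 1) / real (2 * s + 1)" "colourable 3 (odd_frac_power r s G)"
      using \<open>x \<in> S\<close> by (auto simp: S_def)
    have "2 * r + 1 < m * (2 * s + 1)"
      using u um rs(2) by (rule colourable_odd_frac_power_less)
    then have "real (2 * r + 1) < real m * real (2 * s + 1)"
      by (metis of_nat_less_iff of_nat_mult)
    then show ?thesis unfolding rs(1) by (simp add: divide_le_eq)
  qed
  then have bdd: "bdd_above S" by (rule bdd_aboveI)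
  have "colourable 3 (odd_frac_power 0 0 G)"
    using col3 wf by (rule colourable_odd_frac_power_0)
  then have "1 \<in> S" unfolding S_def by force
  then have "theta G = 1 \<longleftrightarrow> (\<forall>x\<in>S. x \<le> 1)"
    unfolding theta using bdd by (rule Sup_eq_iff_no_greater)
  also have "\<dots> \<longleftrightarrow> (\<forall>r s. colourable 3 (odd_frac_power r s G) \<longrightarrow> r \<le> s)"
  proof -
    have le_iff: "r \<le> s \<longleftrightarrow> real (2 * r + 1) / real (2 * s + 1) \<le> 1" for r s
      by (simp add: divide_le_eq)
    show ?thesis unfolding S_def le_iff by blast
  qed
  \<comment> \<open>\<open>K_{n/d}\<close> with \<open>n < 3 * d\<close> makes the exponent
    \<open>(2 * n + 3) / (2 * n + 1)\<close> admissible; conversely \<open>s < r\<close> gives a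
    circular clique below 3.\<close>
  also have "\<dots> \<longleftrightarrow> (\<forall>n d f. 2 * d \<le> n \<and> graph_hom G (circular_clique n d) f \<longrightarrow> 3 * d \<le> n)"
  proof (intro iffI allI impI)
    fix n d f
    assume "\<forall>r s. colourable 3 (odd_frac_power r s G) \<longrightarrow> r \<le> s"
      and "2 * d \<le> n \<and> graph_hom G (circular_clique n d) f"
    then show "3 * d \<le> n"
      using power_three_colourable_if_circular_clique_hom[OF sym, of n d f] by force
  next
    fix r s
    assume ge3: "\<forall>n d f. 2 * d \<le> n \<and> graph_hom G (circular_clique n d) f \<longrightarrow> 3 * d \<le> n"
      and col: "colourable 3 (odd_frac_power r s G)"
    show "r \<le> s"
    proof (rule ccontr)
      assume "\<not> r \<le> s"
      then have "s < r" by simp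
      then obtain f where "graph_hom G (circular_clique (6 * r + 3) (3 * r + 1 - s)) f"
        using circular_clique_hom_if_power_three_colourable[OF wf _ col] by blast
      then have "3 * (3 * r + 1 - s) \<le> 6 * r + 3"
        using ge3[rule_format, of "3 * r + 1 - s" "6 * r + 3" f] by simp
      then show False using \<open>s < r\<close> by simp
    qed
  qed
  also have "\<dots> \<longleftrightarrow> circular_chromatic_number G = 3"
  proof -
    obtain c where "graph_hom G (circular_clique 3 1) c"
      using circular_clique_hom_if_colourable[OF col3 wf] by blast
    then have attained: "circular_chromatic_number G \<le> real 3 / real 1"
      "\<exists>n d f. 0 < d \<and> 2 * d \<le> n \<and> circular_chromatic_number G = real n / real d
         \<and> graph_hom G (circular_clique n d) f"
      by (intro circular_chromatic_number_attained[OF wf pair_finite_verts]; simp)+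
    have le3: "circular_chromatic_number G \<le> 3"
      using attained(1) by simp
    obtain n d f where nd: "0 < d" "2 * d \<le> n" "circular_chromatic_number G = real n / real d"
      "graph_hom G (circular_clique n d) f"
      using attained(2) by blast
    show ?thesis
    proof
      assume "\<forall>n d f. 2 * d \<le> n \<and> graph_hom G (circular_clique n d) f \<longrightarrow> 3 * d \<le> n"
      then have "real (3 * d) \<le> real n" using nd by (blast intro: of_nat_mono)
      then have "3 \<le> circular_chromatic_number G"
        unfolding nd(3) using nd(1) by (simp add: le_divide_eq)
      then show "circular_chromatic_number G = 3" using le3 by simp
    next
      assume eq: "circular_chromatic_number G = 3"
      show "\<forall>n d f. 2 * d \<le> n \<and> graph_hom G (circular_clique n d) f \<longrightarrow> 3 * d \<le> n"
      proof (intro allI impI)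
        fix n d f assume *: "2 * d \<le> n \<and> graph_hom G (circular_clique n d) f"
        show "3 * d \<le> n"
        proof (cases "d = 0")
          case False
          then have "3 \<le> real n / real d"
            using circular_chromatic_number_attained(1)[OF wf pair_finite_verts, of d n f] * eq by simp
          then have "real (3 * d) \<le> real n" using False by (simp add: le_divide_eq)
          then show ?thesis by (simp only: of_nat_le_iff)
        qed simp
      qed
    qed
  qed
  finally show ?thesis .
qed

end
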